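(* Let $a,b>0$ with $a\neq b$. Then each of the four functions $p\mapsto P_p(a,b)$, $p\mapsto T_p(a,b)$, $p\mapsto N_p(a,b)$ and $p\mapsto Z_p(a,b)$ is strictly increasing on $\mathbb{R}$.
   Context: For $a,b>0$ with $a\ne b$ define the first Seiffert mean $P(a,b)=\dfrac{a-b}{2\arcsin\frac{a-b}{a+b}}$, the second Seiffert mean $T(a,b)=\dfrac{a-b}{2\arctan\frac{a-b}{a+b}}$, and the Neuman-Sándor mean $N(a,b)=\dfrac{a-b}{2\,\mathrm{arcsinh}\frac{a-b}{a+b}}$, with $P(a,a)=T(a,a)=N(a,a)=a$. For $a,b>0$ define the power-exponential mean $Z(a,b)=a^{\frac{a}{a+b}}b^{\frac{b}{a+b}}$. For $M\in\{P,T,N,Z\}$ and $p\in\mathbb{R}$ set $M_p(a,b)=\left(M(a^p,b^p)\right)^{1/p}$ if $p\ne0$, and $M_0(a,b)=\sqrt{ab}$. *)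

theory Defs
  imports Complex_Main
begin

(* Bivariate means of positive reals; values at nonpositive arguments are irrelevant. *)

definition seiffert1 :: "real \<Rightarrow> real \<Rightarrow> real" where
  "seiffert1 a b = (if a = b then a else (a - b) / (2 * arcsin ((a - b) / (a + b))))"

definition seiffert2 :: "real \<Rightarrow> real \<Rightarrow> real" where
  "seiffert2 a b = (if a = b then a else (a - b) / (2 * arctan ((a - b) / (a + b))))"

definition neuman_sandor :: "real \<Rightarrow> real \<Rightarrow> real" where
  "neuman_sandor a b = (if a = b then a else (a - b) / (2 * arsinh ((a - b) / (a + b))))"

definition power_exp_mean :: "real \<Rightarrow> real \<Rightarrow> real" where
  "power_exp_mean a b = a powr (a / (a + b)) * b powr (b / (a + b))"

definition mean_of_order :: "(real \<Rightarrow> real \<Rightarrow> real) \<Rightarrow> real \<Rightarrow> real \<Rightarrow> real \<Rightarrow> real" where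
  "mean_of_order M p a b =
    (if p = 0 then sqrt (a * b) else (M (a powr p) (b powr p)) powr (1 / p))"

end

theory Submission
  imports Defs
begin

text \<open>
  Write \<open>a = g * exp L\<close> and \<open>b = g * exp (- L)\<close>, where \<open>g\<close> is the geometric mean of \<open>a\<close> and \<open>b\<close>.
  Each of the four means is symmetric and homogeneous of degree one, so
  \<open>M (g * exp t) (g * exp (- t)) = g * exp (m t)\<close> for an even function \<open>m\<close>, and the mean of order
  \<open>p\<close> equals \<open>g * exp (L * (m (p * L) / (p * L)))\<close>. Everything therefore reduces to showing that
  the slope \<open>m t / t\<close> is strictly increasing on the whole line (\<open>mean_of_order_strict_mono\<close>).

  For the power-exponential mean \<open>m t = t * tanh t\<close>, and the slope is \<open>tanh\<close>. For the other three
  means \<open>m t = ln (sinh t / h t)\<close> with \<open>h t = A (tanh t)\<close>, where \<open>A\<close> is \<open>arcsin\<close>, \<open>arctan\<close> or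
  \<open>arsinh\<close>. The slope is odd and, as \<open>h < sinh\<close>, positive for positive \<open>t\<close>; since \<open>m\<close> tends to
  \<open>0\<close> at the origin, strict convexity of \<open>m\<close> on the positive half-line makes the slope increase.
  With \<open>s = sinh t\<close>, the condition \<open>m'' t > 0\<close> is the inequality
  \<open>h\<^sup>2 + h * h'' * s\<^sup>2 - h'\<^sup>2 * s\<^sup>2 < 0\<close> (\<open>seiffert_type_slope_strict_mono\<close>). Its left-hand side is a
  quadratic polynomial in the value \<open>h\<close> with negative constant term, so the inequality is an upper
  bound on \<open>h\<close>. That bound follows from \<open>arcsin (tanh t) < sinh t\<close> for \<open>P\<close>, where \<open>sinh t\<close> is
  the positive root itself, and from \<open>A (tanh t) < tanh t\<close> for \<open>T\<close> and \<open>N\<close>.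
\<close>

section \<open>Slopes of functions vanishing at the origin\<close>

lemma strict_mono_odd_from_pos:
  fixes f :: "real \<Rightarrow> real"
  assumes odd: "\<And>t. f (- t) = - f t"
    and pos: "\<And>t. 0 < t \<Longrightarrow> 0 < f t"
    and mono: "\<And>s t. 0 < s \<Longrightarrow> s < t \<Longrightarrow> f s < f t"
  shows "strict_mono f"
proof (rule strict_monoI)
  fix s t :: real
  assume "s < t"
  have f0: "f 0 = 0"
    using odd[of 0] by simp
  consider "0 < s" | "s = 0" | "s < 0" "0 < t" | "t = 0" | "t < 0"
    by linarith
  then show "f s < f t"
  proof cases
    case 1
    then show ?thesis using mono \<open>s < t\<close> by blast
  next
    case 2
    then show ?thesis using pos \<open>s < t\<close> f0 by simp
  next
    case 3
    then have "0 < f (- s)" "0 < f t" using pos by auto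
    then show ?thesis using odd[of s] by linarith
  next
    case 4
    then have "0 < f (- s)" using pos \<open>s < t\<close> by auto
    then show ?thesis using odd[of s] f0 4 by simp
  next
    case 5
    then have "f (- t) < f (- s)" using mono \<open>s < t\<close> by auto
    then show ?thesis using odd[of s] odd[of t] by linarith
  qed
qed

text \<open>
  By the mean value theorem \<open>m s / s\<close> is a value of \<open>m'\<close> on \<open>]0, s[\<close>, and the slope of the chord
  over \<open>[s, t]\<close> is a value of \<open>m'\<close> further right, hence larger. The slope \<open>m t / t\<close> is a convex
  combination of these two numbers.
\<close>

lemma slope_less_if_derivative_increasing:
  fixes m m' :: "real \<Rightarrow> real"
  assumes m0: "m 0 = 0"
    and cont: "(m \<longlongrightarrow> 0) (at 0)"
    and der: "\<And>x. 0 < x \<Longrightarrow> (m has_real_derivative m' x) (at x)"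
    and inc: "\<And>x y. 0 < x \<Longrightarrow> x < y \<Longrightarrow> m' x < m' y"
    and st: "0 < s" "s < t"
  shows "m s / s < m t / t"
proof -
  have "continuous_on {0..t} m"
  proof (intro continuous_at_imp_continuous_on ballI)
    fix x assume x: "x \<in> {0..t}"
    show "isCont m x"
    proof (cases "x = 0")
      case True
      then show ?thesis using cont m0 by (simp add: isCont_def)
    next
      case False
      then show ?thesis using der[of x] x by (auto intro: DERIV_isCont)
    qed
  qed
  then have c: "continuous_on {0..s} m" "continuous_on {s..t} m"
    using st by (simp_all add: continuous_on_subset)
  have "\<exists>l z. 0 < z \<and> z < s \<and> (m has_real_derivative l) (at z) \<and> m s - m 0 = (s - 0) * l"
    using st c der by (intro MVT) (auto simp: real_differentiable_def)
  then obtain l x where x: "0 < x" "x < s" "(m has_real_derivative l) (at x)" "m s = s * l"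
    using m0 by auto
  have "\<exists>l z. s < z \<and> z < t \<and> (m has_real_derivative l) (at z) \<and> m t - m s = (t - s) * l"
  proof (intro MVT)
    fix u assume "s < u" "u < t"
    then have "0 < u" using st by simp
    then show "m differentiable (at u)" using der real_differentiable_def by blast
  qed (use st c in auto)
  then obtain k y where y: "s < y" "y < t" "(m has_real_derivative k) (at y)"
      "m t - m s = (t - s) * k"
    by auto
  have "l = m' x" "k = m' y"
    using x y st der DERIV_unique by (meson less_trans)+
  then have "l < k"
    using inc x y by auto
  then have "(t - s) * l < (t - s) * k"
    using st by simp
  then have "t * l < m t"
    using x y by (simp add: algebra_simps)
  then have "l < m t / t"
    using st by (simp add: field_simps)
  then show ?thesis
    using x st by simp
qed

lemma less_if_derivative_less:
  fixes f g f' g' :: "real \<Rightarrow> real"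
  assumes "f 0 = g 0"
    and "\<And>x. (f has_real_derivative f' x) (at x)"
    and "\<And>x. (g has_real_derivative g' x) (at x)"
    and "\<And>x. 0 < x \<Longrightarrow> f' x < g' x"
    and "0 < t"
  shows "f t < g t"
proof -
  have d: "((\<lambda>x. g x - f x) has_real_derivative g' x - f' x) (at x)" for x
    using assms by (intro derivative_intros)
  have "g 0 - f 0 < g t - f t"
  proof (rule DERIV_pos_imp_increasing_open[OF \<open>0 < t\<close>])
    show "\<exists>y. ((\<lambda>x. g x - f x) has_real_derivative y) (at x) \<and> 0 < y" if "0 < x" "x < t" for x
      using d[of x] assms(4)[of x] that by (intro exI[of _ "g' x - f' x"]) simp
    show "continuous_on {0..t} (\<lambda>x. g x - f x)"
      using d by (intro continuous_at_imp_continuous_on ballI DERIV_isCont)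
  qed
  then show ?thesis using assms by simp
qed

section \<open>Means of order p as functions of a slope\<close>

text \<open>
  The common factor \<open>(a b)\<close> to the power \<open>p / 2\<close> leaves the mean as the geometric mean, and what
  remains is \<open>exp (m (p * L) / p)\<close>. With \<open>L\<close> as an outer factor the dependence on \<open>p\<close> is only through
  the slope of \<open>m\<close>. The convention \<open>x / 0 = 0\<close> gives the slope the value \<open>0\<close> at the origin, which is
  exactly what turns the order \<open>0\<close> into the geometric mean.
\<close>

lemma mean_of_order_as_slope:
  fixes M :: "real \<Rightarrow> real \<Rightarrow> real" and m :: "real \<Rightarrow> real"
  assumes hom: "\<And>g t. 0 < g \<Longrightarrow> t \<noteq> 0 \<Longrightarrow> M (g * exp t) (g * exp (- t)) = g * exp (m t)"
    and ab: "0 < a" "0 < b" "a \<noteq> b"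
  defines "L \<equiv> (ln a - ln b) / 2"
  shows "mean_of_order M p a b = sqrt (a * b) * exp (L * (m (p * L) / (p * L)))"
proof (cases "p = 0")
  case True
  then show ?thesis by (simp add: mean_of_order_def)
next
  case False
  define g where "g = exp (p * ((ln a + ln b) / 2))"
  have L: "L \<noteq> 0" using ab by (simp add: L_def)
  have "a powr p = g * exp (p * L)" "b powr p = g * exp (- (p * L))"
    using ab unfolding g_def L_def powr_def mult_exp_exp by (simp_all add: field_simps)
  then have "mean_of_order M p a b = (g * exp (m (p * L))) powr (1 / p)"
    using False L hom[of g "p * L"] by (simp add: mean_of_order_def g_def)
  also have "\<dots> = exp ((ln a + ln b) / 2) * exp (m (p * L) / p)"
    using False unfolding g_def mult_exp_exp by (simp add: powr_def field_simps)
  also have "exp ((ln a + ln b) / 2) = sqrt (a * b)"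
  proof -
    have "(ln a + ln b) / 2 = ln (sqrt (a * b))"
      using ab by (simp add: ln_sqrt ln_mult)
    then show ?thesis using ab by simp
  qed
  also have "m (p * L) / p = L * (m (p * L) / (p * L))"
    using L by simp
  finally show ?thesis .
qed

text \<open>
  If \<open>L\<close> is negative, then \<open>p * L\<close> decreases in \<open>p\<close>, but the outer factor \<open>L\<close> reverses the inequality
  a second time.
\<close>

lemma mean_of_order_strict_mono:
  fixes M :: "real \<Rightarrow> real \<Rightarrow> real" and m :: "real \<Rightarrow> real"
  assumes hom: "\<And>g t. 0 < g \<Longrightarrow> t \<noteq> 0 \<Longrightarrow> M (g * exp t) (g * exp (- t)) = g * exp (m t)"
    and slope: "strict_mono (\<lambda>t. m t / t)"
    and ab: "0 < a" "0 < b" "a \<noteq> b"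
  shows "strict_mono (\<lambda>p. mean_of_order M p a b)"
proof (rule strict_monoI)
  fix p q :: real
  assume "p < q"
  define L where "L = (ln a - ln b) / 2"
  have "L * (m (p * L) / (p * L)) < L * (m (q * L) / (q * L))"
  proof (cases "0 < L")
    case True
    then have "p * L < q * L" using \<open>p < q\<close> by simp
    from strict_monoD[OF slope this] show ?thesis using True by (intro mult_strict_left_mono)
  next
    case False
    then have "L < 0" using ab by (simp add: L_def)
    then have "q * L < p * L" using \<open>p < q\<close> by simp
    from strict_monoD[OF slope this] show ?thesis using \<open>L < 0\<close>
      by (intro mult_strict_left_mono_neg)
  qed
  then show "mean_of_order M p a b < mean_of_order M q a b"
    using ab by (simp add: mean_of_order_as_slope[OF hom ab] L_def[symmetric])
qed

section \<open>Power-exponential mean\<close>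

lemma power_exp_mean_exp:
  assumes "0 < g"
  shows "power_exp_mean (g * exp t) (g * exp (- t)) = g * exp (t * tanh t)"
proof -
  define u where "u = exp t + exp (- t)"
  have u: "u > 0" unfolding u_def by (intro add_pos_pos) auto
  have w: "g * exp t / (g * exp t + g * exp (- t)) = exp t / u"
      "g * exp (- t) / (g * exp t + g * exp (- t)) = exp (- t) / u"
    using assms unfolding u_def by (simp_all flip: distrib_left)
  have "power_exp_mean (g * exp t) (g * exp (- t))
      = exp (exp t / u * (ln g + t) + exp (- t) / u * (ln g - t))"
    using assms unfolding power_exp_mean_def w
    by (simp add: powr_def ln_mult exp_add)
  also have "exp t / u * (ln g + t) + exp (- t) / u * (ln g - t) = ln g + t * tanh t"
  proof -
    have halves: "sinh t = (exp t - exp (- t)) / 2" "cosh t = u / 2"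
      by (simp_all add: sinh_field_def cosh_field_def u_def)
    have "(x / 2) / (u / 2) = x / u" for x
      by simp
    then have "tanh t = exp t / u - exp (- t) / u"
      unfolding tanh_def halves diff_divide_distrib[symmetric] .
    moreover have "exp t / u + exp (- t) / u = 1"
      using u by (simp add: u_def flip: add_divide_distrib)
    ultimately have "p * (ln g + t) + q * (ln g - t) = ln g + t * tanh t"
      if "p = exp t / u" "q = exp (- t) / u" for p q
      unfolding that[symmetric] by algebra
    then show ?thesis by blast
  qed
  also have "exp (ln g + t * tanh t) = g * exp (t * tanh t)"
    using assms by (simp add: exp_add)
  finally show ?thesis .
qed

lemma power_exp_mean_of_order_strict_mono:
  assumes "0 < a" "0 < b" "a \<noteq> b"
  shows "strict_mono (\<lambda>p. mean_of_order power_exp_mean p a b)"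
proof (rule mean_of_order_strict_mono[where m = "\<lambda>t. t * tanh t", OF _ _ assms])
  have "(\<lambda>t::real. t * tanh t / t) = tanh"
    by (rule ext) simp
  then show "strict_mono (\<lambda>t::real. t * tanh t / t)"
    using tanh_real_strict_mono by simp
qed (rule power_exp_mean_exp)

section \<open>Seiffert-type means\<close>

lemma seiffert_type_mean_exp:
  fixes A :: "real \<Rightarrow> real"
  assumes g: "0 < g" and pos: "0 < sinh t / A (tanh t)"
  shows "(g * exp t - g * exp (- t)) / (2 * A ((g * exp t - g * exp (- t)) / (g * exp t + g * exp (- t))))
    = g * exp (ln (sinh t / A (tanh t)))"
proof -
  have d: "g * exp t - g * exp (- t) = 2 * g * sinh t"
    by (simp add: sinh_field_def right_diff_distrib)
  have s: "g * exp t + g * exp (- t) = 2 * g * cosh t"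
    by (simp add: cosh_field_def distrib_left)
  have "(g * exp t - g * exp (- t)) / (g * exp t + g * exp (- t)) = tanh t"
    unfolding d s using g by (simp add: tanh_def)
  then show ?thesis
    using pos by (simp add: d)
qed

text \<open>
  Both \<open>sinh\<close> and \<open>h\<close> vanish at the origin with derivative \<open>1\<close>, so their ratio tends to \<open>1\<close>.
\<close>

lemma log_ratio_tendsto_0:
  fixes h :: "real \<Rightarrow> real"
  assumes "(h has_real_derivative 1) (at 0)" "h 0 = 0"
  shows "((\<lambda>t. ln (sinh t / h t)) \<longlongrightarrow> 0) (at 0)"
proof -
  have h: "((\<lambda>t. h t / t) \<longlongrightarrow> 1) (at 0)"
    using assms by (simp add: has_field_derivative_iff)
  have "(sinh has_real_derivative 1) (at 0)"
    by (auto intro!: derivative_eq_intros)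
  then have s: "((\<lambda>t::real. sinh t / t) \<longlongrightarrow> 1) (at 0)"
    by (simp add: has_field_derivative_iff)
  have "((\<lambda>t. ln ((sinh t / t) / (h t / t))) \<longlongrightarrow> ln (1 / 1)) (at 0)"
    by (intro tendsto_intros h s) auto
  moreover have "\<forall>\<^sub>F t in at 0. ln ((sinh t / t) / (h t / t)) = ln (sinh t / h t)"
    by (auto simp: eventually_at_filter)
  ultimately show ?thesis
    by (simp add: tendsto_cong)
qed

text \<open>
  The second derivative of \<open>ln (sinh t / h t)\<close> is \<open>(h1 / h)\<^sup>2 - h2 / h - 1 / (sinh t)\<^sup>2\<close>; multiplied by
  \<open>(h t)\<^sup>2 * (sinh t)\<^sup>2\<close>, its positivity becomes the hypothesis \<open>quad\<close>. The hypothesis \<open>less\<close> makes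
  the logarithm positive, which is needed to pass from the positive half-line across the origin.
\<close>

lemma seiffert_type_slope_strict_mono:
  fixes h h1 h2 :: "real \<Rightarrow> real"
  assumes odd: "\<And>t. h (- t) = - h t"
    and d1: "\<And>t. (h has_real_derivative h1 t) (at t)"
    and d2: "\<And>t. (h1 has_real_derivative h2 t) (at t)"
    and h10: "h1 0 = 1"
    and pos: "\<And>t. 0 < t \<Longrightarrow> 0 < h t"
    and less: "\<And>t. 0 < t \<Longrightarrow> h t < sinh t"
    and quad: "\<And>t. 0 < t \<Longrightarrow> (h t)\<^sup>2 + h t * h2 t * (sinh t)\<^sup>2 < (h1 t)\<^sup>2 * (sinh t)\<^sup>2"
  shows "strict_mono (\<lambda>t. ln (sinh t / h t) / t)"
proof (rule strict_mono_odd_from_pos)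
  show "ln (sinh (- t) / h (- t)) / - t = - (ln (sinh t / h t) / t)" for t
    by (simp add: odd)
  show "0 < ln (sinh t / h t) / t" if "0 < t" for t
    using pos[OF that] less[OF that] that by simp
next
  fix s t :: real
  assume st: "0 < s" "s < t"
  define m' where "m' = (\<lambda>t. cosh t / sinh t - h1 t / h t)"
  define m'' where "m'' = (\<lambda>t. (h1 t / h t)\<^sup>2 - h2 t / h t - 1 / (sinh t)\<^sup>2)"
  have m': "((\<lambda>t. ln (sinh t / h t)) has_real_derivative m' x) (at x)" if "0 < x" for x
    unfolding m'_def using pos[OF that] that
    by (auto intro!: derivative_eq_intros d1 simp: field_simps power2_eq_square)
  have m'': "(m' has_real_derivative m'' x) (at x)" if "0 < x" for x
  proof -
    have c: "(cosh x)\<^sup>2 = (sinh x)\<^sup>2 + 1" by (rule cosh_square_eq)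
    have "(m' has_real_derivative
        ((sinh x * sinh x - cosh x * cosh x) / (sinh x * sinh x)
         - (h2 x * h x - h1 x * h1 x) / (h x * h x))) (at x)"
      unfolding m'_def using pos[OF that] that
      by (auto intro!: derivative_eq_intros d1 d2)
    also have "(sinh x * sinh x - cosh x * cosh x) / (sinh x * sinh x)
         - (h2 x * h x - h1 x * h1 x) / (h x * h x) = m'' x"
      unfolding m''_def using pos[OF that] that c
      by (simp add: power2_eq_square diff_divide_distrib add_divide_distrib)
    finally show ?thesis .
  qed
  have m''_pos: "0 < m'' x" if "0 < x" for x
  proof -
    have "m'' x = ((h1 x)\<^sup>2 * (sinh x)\<^sup>2 - ((h x)\<^sup>2 + h x * h2 x * (sinh x)\<^sup>2)) / ((h x)\<^sup>2 * (sinh x)\<^sup>2)"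
      unfolding m''_def using pos[OF that] that by (simp add: field_simps power2_eq_square)
    also have "0 < \<dots>"
      using pos[OF that] quad[OF that] that by (intro divide_pos_pos) auto
    finally show ?thesis .
  qed
  have h0: "h 0 = 0" using odd[of 0] by simp
  \<comment> \<open>At the origin \<open>ln (0 / 0) = ln 0 = 0\<close> by convention, which is also the limit.\<close>
  show "ln (sinh s / h s) / s < ln (sinh t / h t) / t"
  proof (rule slope_less_if_derivative_increasing[where m = "\<lambda>t. ln (sinh t / h t)" and m' = m'])
    show "((\<lambda>t. ln (sinh t / h t)) \<longlongrightarrow> 0) (at 0)"
      using log_ratio_tendsto_0 d1[of 0] h10 h0 by simp
    show "m' x < m' y" if "0 < x" "x < y" for x y
    proof (rule DERIV_pos_imp_increasing[OF \<open>x < y\<close>])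
      fix z assume "x \<le> z"
      then have "0 < z" using that by simp
      then show "\<exists>d. (m' has_real_derivative d) (at z) \<and> 0 < d"
        using m'' m''_pos by blast
    qed
  qed (use m' st h0 in auto)
qed

lemma seiffert_type_mean_of_order_strict_mono:
  fixes A h1 h2 :: "real \<Rightarrow> real"
  assumes M: "\<And>x y. M x y = (if x = y then x else (x - y) / (2 * A ((x - y) / (x + y))))"
    and odd: "\<And>t. A (tanh (- t)) = - A (tanh t)"
    and d1: "\<And>t. ((\<lambda>t. A (tanh t)) has_real_derivative h1 t) (at t)"
    and d2: "\<And>t. (h1 has_real_derivative h2 t) (at t)"
    and h10: "h1 0 = 1"
    and pos: "\<And>t. 0 < t \<Longrightarrow> 0 < A (tanh t)"
    and less: "\<And>t. 0 < t \<Longrightarrow> A (tanh t) < sinh t"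
    and quad: "\<And>t. 0 < t \<Longrightarrow>
      (A (tanh t))\<^sup>2 + A (tanh t) * h2 t * (sinh t)\<^sup>2 < (h1 t)\<^sup>2 * (sinh t)\<^sup>2"
    and ab: "0 < a" "0 < b" "a \<noteq> b"
  shows "strict_mono (\<lambda>p. mean_of_order M p a b)"
proof (rule mean_of_order_strict_mono[where m = "\<lambda>t. ln (sinh t / A (tanh t))", OF _ _ ab])
  show "strict_mono (\<lambda>t. ln (sinh t / A (tanh t)) / t)"
    by (rule seiffert_type_slope_strict_mono[OF odd d1 d2 h10 pos less quad])
next
  fix g t :: real
  assume g: "0 < g" and t: "t \<noteq> 0"
  have "0 < sinh t / A (tanh t)"
  proof (cases "0 < t")
    case True
    then show ?thesis using pos by simp
  next
    case False
    then have "0 < A (tanh (- t))" "sinh t < 0" using pos[of "- t"] t by auto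
    then show ?thesis using odd[of t] by (simp add: divide_neg_neg)
  qed
  with g t show "M (g * exp t) (g * exp (- t)) = g * exp (ln (sinh t / A (tanh t)))"
    unfolding M by (subst if_not_P) (simp_all add: seiffert_type_mean_exp)
qed

section \<open>First Seiffert mean\<close>

lemma one_minus_tanh_square: "1 - (tanh t)\<^sup>2 = 1 / (cosh t)\<^sup>2" for t :: real
  by (simp add: tanh_def power_divide sinh_square_eq diff_divide_distrib)

lemma has_derivative_arcsin_tanh:
  "((\<lambda>t. arcsin (tanh t)) has_real_derivative 1 / cosh t) (at t)"
proof -
  have "((\<lambda>t. arcsin (tanh t)) has_real_derivative
      inverse (sqrt (1 - (tanh t)\<^sup>2)) * (1 - (tanh t)\<^sup>2)) (at t)"
    using tanh_real_bounds[of t] by (auto intro!: derivative_eq_intros)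
  also have "inverse (sqrt (1 - (tanh t)\<^sup>2)) * (1 - (tanh t)\<^sup>2) = 1 / cosh t"
    unfolding one_minus_tanh_square by (simp add: real_sqrt_divide power2_eq_square)
  finally show ?thesis .
qed

lemma seiffert1_of_order_strict_mono:
  assumes "0 < a" "0 < b" "a \<noteq> b"
  shows "strict_mono (\<lambda>p. mean_of_order seiffert1 p a b)"
proof (rule seiffert_type_mean_of_order_strict_mono[OF seiffert1_def _ has_derivative_arcsin_tanh
      _ _ _ _ _ assms])
  show "arcsin (tanh (- t)) = - arcsin (tanh t)" for t :: real
    using tanh_real_bounds[of t] by (simp add: arcsin_minus)
  show "((\<lambda>t. 1 / cosh t) has_real_derivative - sinh t / (cosh t)\<^sup>2) (at t)" for t :: real
    by (auto intro!: derivative_eq_intros simp: power2_eq_square)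
  show pos: "0 < arcsin (tanh t)" if "0 < t" for t :: real
    using arcsin_less_arcsin[of 0 "tanh t"] tanh_real_bounds[of t] that by simp
  show less: "arcsin (tanh t) < sinh t" if "0 < t" for t :: real
  proof (rule less_if_derivative_less[OF _ has_derivative_arcsin_tanh _ _ that])
    show "(sinh has_real_derivative cosh x) (at x)" for x :: real
      by (auto intro!: derivative_eq_intros)
    show "1 / cosh x < cosh x" if "0 < x" for x :: real
    proof -
      have "1 < cosh x" using cosh_real_strict_mono[of 0 x] that by simp
      then have "1 < cosh x * cosh x" using less_1_mult by blast
      then show ?thesis by (simp add: field_simps)
    qed
  qed simp
  fix t :: real
  assume "0 < t"
  define h where "h = arcsin (tanh t)"
  define s where "s = sinh t"
  define c where "c = cosh t"
  have c: "c\<^sup>2 = s\<^sup>2 + 1" "c > 0" by (simp_all add: c_def s_def cosh_square_eq)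
  have "0 < h" "h < s" using pos less \<open>0 < t\<close> by (simp_all add: h_def s_def)
  \<comment> \<open>The quadratic polynomial in \<open>h\<close> has the roots \<open>s\<close> and \<open>- s / c\<^sup>2\<close>.\<close>
  then have "(h - s) * (h + s / c\<^sup>2) < 0"
    using c by (intro mult_neg_pos add_pos_nonneg) auto
  moreover have "(h - s) * (h + s / c\<^sup>2) = h\<^sup>2 + h * (- s / c\<^sup>2) * s\<^sup>2 - (1 / c)\<^sup>2 * s\<^sup>2"
  proof -
    define k where "k = s / c\<^sup>2"
    have "s = k * c\<^sup>2" using c(2) by (simp add: k_def)
    then have "k * s\<^sup>2 = s - k" unfolding c(1) by (simp add: algebra_simps)
    moreover have "(1 / c)\<^sup>2 * s\<^sup>2 = k * s" by (simp add: k_def power2_eq_square)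
    moreover have "- s / c\<^sup>2 = - k" by (simp add: k_def)
    ultimately show ?thesis unfolding k_def[symmetric] by algebra
  qed
  ultimately show "(arcsin (tanh t))\<^sup>2 + arcsin (tanh t) * (- sinh t / (cosh t)\<^sup>2) * (sinh t)\<^sup>2
      < (1 / cosh t)\<^sup>2 * (sinh t)\<^sup>2"
    unfolding h_def s_def c_def by linarith
qed simp

section \<open>Second Seiffert mean\<close>

lemma has_derivative_tanh_cosh:
  "(tanh has_real_derivative 1 / (cosh t)\<^sup>2) (at t)"
proof -
  have "(tanh has_real_derivative 1 - (tanh t)\<^sup>2) (at t)"
    by (auto intro!: derivative_eq_intros)
  then show ?thesis
    unfolding one_minus_tanh_square .
qed

lemma one_add_tanh_square:
  "1 + (tanh t)\<^sup>2 = ((cosh t)\<^sup>2 + (sinh t)\<^sup>2) / (cosh t)\<^sup>2" for t :: real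
  by (simp add: tanh_def power_divide add_divide_distrib)

lemma has_derivative_arctan_tanh:
  "((\<lambda>t. arctan (tanh t)) has_real_derivative 1 / ((cosh t)\<^sup>2 + (sinh t)\<^sup>2)) (at t)"
proof -
  have "((\<lambda>t. arctan (tanh t)) has_real_derivative
      inverse (1 + (tanh t)\<^sup>2) * (1 / (cosh t)\<^sup>2)) (at t)"
    by (intro DERIV_chain2[OF DERIV_arctan] has_derivative_tanh_cosh)
  then show ?thesis
    unfolding one_add_tanh_square by simp
qed

lemma cosh_square_add_sinh_square_pos: "0 < (cosh t)\<^sup>2 + (sinh t)\<^sup>2" for t :: real
  by (intro add_pos_nonneg) auto

lemma tanh_less_sinh: "tanh t < sinh t" if "0 < t" for t :: real
proof -
  have "1 < cosh t" using cosh_real_strict_mono[of 0 t] that by simp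
  then show ?thesis using that by (simp add: tanh_def field_simps)
qed

lemma seiffert2_of_order_strict_mono:
  assumes "0 < a" "0 < b" "a \<noteq> b"
  shows "strict_mono (\<lambda>p. mean_of_order seiffert2 p a b)"
proof (rule seiffert_type_mean_of_order_strict_mono[OF seiffert2_def _ has_derivative_arctan_tanh
      _ _ _ _ _ assms])
  show "((\<lambda>t. 1 / ((cosh t)\<^sup>2 + (sinh t)\<^sup>2)) has_real_derivative
      - 4 * sinh t * cosh t / ((cosh t)\<^sup>2 + (sinh t)\<^sup>2)\<^sup>2) (at t)" for t :: real
    using cosh_square_add_sinh_square_pos[of t]
    by (auto intro!: derivative_eq_intros simp: power2_eq_square field_simps)
  show pos: "0 < arctan (tanh t)" if "0 < t" for t :: real
    using that by simp
  have less: "arctan (tanh t) < tanh t" if "0 < t" for t :: real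
    by (rule less_if_derivative_less[OF _ has_derivative_arctan_tanh has_derivative_tanh_cosh _ that])
      (auto intro!: divide_strict_left_mono mult_pos_pos cosh_square_add_sinh_square_pos)
  then show "arctan (tanh t) < sinh t" if "0 < t" for t :: real
    using tanh_less_sinh that by fastforce
  fix t :: real
  assume t: "0 < t"
  define h where "h = arctan (tanh t)"
  define s where "s = sinh t"
  define c where "c = cosh t"
  define D where "D = c\<^sup>2 + s\<^sup>2"
  have c: "c\<^sup>2 = s\<^sup>2 + 1" "c > 0" "s > 0" using t by (simp_all add: c_def s_def cosh_square_eq)
  have D: "D > 0" unfolding D_def using c(2) by (intro add_pos_nonneg) auto
  have D2: "D\<^sup>2 = 4 * s\<^sup>2 * c\<^sup>2 + 1"
    unfolding D_def using c by algebra
  have h: "0 < h" "h < s / c" using pos less t by (simp_all add: h_def s_def c_def tanh_def)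
  \<comment> \<open>The bound \<open>h < s / c\<close> is used twice: it makes the polynomial linear in \<open>h\<close>, and since
    \<open>D\<^sup>2 - 4 * s\<^sup>2 * c\<^sup>2 = 1\<close> the resulting coefficient of \<open>h\<close> is positive, so it applies again.\<close>
  have "h * h < h * (s / c)"
    using h by (intro mult_strict_left_mono)
  then have "h * h + h * (- 4 * s * c / D\<^sup>2) * s\<^sup>2 < h * (s / c) + h * (- 4 * s * c / D\<^sup>2) * s\<^sup>2"
    by simp
  also have "\<dots> = h * (s * (D\<^sup>2 - 4 * s\<^sup>2 * c\<^sup>2) / (c * D\<^sup>2))"
    using c(2,3) D by (simp add: field_simps power2_eq_square)
  also have "\<dots> = h * (s / (c * D\<^sup>2))"
    by (simp add: D2)
  also have "\<dots> < s / c * (s / (c * D\<^sup>2))"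
    using h c D by (intro mult_strict_right_mono) auto
  also have "\<dots> = (1 / D)\<^sup>2 * s\<^sup>2 * (1 / c\<^sup>2)"
    by (simp add: power2_eq_square)
  also have "\<dots> \<le> (1 / D)\<^sup>2 * s\<^sup>2 * 1"
    using c(1) by (intro mult_left_mono) (auto simp: divide_le_eq_1 add_nonneg_pos)
  finally show "(arctan (tanh t))\<^sup>2
      + arctan (tanh t) * (- 4 * sinh t * cosh t / ((cosh t)\<^sup>2 + (sinh t)\<^sup>2)\<^sup>2) * (sinh t)\<^sup>2
      < (1 / ((cosh t)\<^sup>2 + (sinh t)\<^sup>2))\<^sup>2 * (sinh t)\<^sup>2"
    by (simp add: h_def s_def c_def D_def power2_eq_square)
qed (simp_all add: arctan_minus)

section \<open>Neuman-Sandor mean\<close>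

lemma has_derivative_arsinh_tanh:
  "((\<lambda>t. arsinh (tanh t)) has_real_derivative 1 / (cosh t * sqrt ((cosh t)\<^sup>2 + (sinh t)\<^sup>2))) (at t)"
proof -
  have "sqrt ((tanh t)\<^sup>2 + 1) = sqrt ((cosh t)\<^sup>2 + (sinh t)\<^sup>2) / cosh t"
    using one_add_tanh_square[of t] by (simp add: real_sqrt_divide add.commute)
  then have "1 / sqrt ((tanh t)\<^sup>2 + 1) * (1 / (cosh t)\<^sup>2)
      = 1 / (cosh t * sqrt ((cosh t)\<^sup>2 + (sinh t)\<^sup>2))"
    by (simp add: power2_eq_square[of "cosh t"])
  moreover have "((\<lambda>t. arsinh (tanh t)) has_real_derivative
      1 / sqrt ((tanh t)\<^sup>2 + 1) * (1 / (cosh t)\<^sup>2)) (at t)"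
    by (intro DERIV_chain2[OF arsinh_real_has_field_derivative] has_derivative_tanh_cosh)
  ultimately show ?thesis
    by simp
qed

lemma neuman_sandor_of_order_strict_mono:
  assumes "0 < a" "0 < b" "a \<noteq> b"
  shows "strict_mono (\<lambda>p. mean_of_order neuman_sandor p a b)"
proof (rule seiffert_type_mean_of_order_strict_mono[OF neuman_sandor_def _ has_derivative_arsinh_tanh
      _ _ _ _ _ assms])
  let ?D = "\<lambda>t::real. (cosh t)\<^sup>2 + (sinh t)\<^sup>2"
  let ?h1 = "\<lambda>t. 1 / (cosh t * sqrt (?D t))"
  show "(?h1 has_real_derivative
      - ?h1 t * (sinh t / cosh t + 2 * sinh t * cosh t / ?D t)) (at t)" for t :: real
  proof -
    define R where "R = sqrt (?D t)"
    have R: "R > 0" "?D t = R * R"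
      using cosh_square_add_sinh_square_pos[of t] by (simp_all add: R_def)
    have "((\<lambda>t. sqrt (?D t)) has_real_derivative 2 * sinh t * cosh t / R) (at t)"
      using cosh_square_add_sinh_square_pos[of t]
      by (auto intro!: derivative_eq_intros simp: R_def field_simps)
    then have "(?h1 has_real_derivative
        - (sinh t * R + 2 * sinh t * cosh t / R * cosh t) / (cosh t * R)\<^sup>2) (at t)"
      using R by (auto intro!: derivative_eq_intros simp: R_def[symmetric] power2_eq_square field_simps)
    also have "- (sinh t * R + 2 * sinh t * cosh t / R * cosh t) / (cosh t * R)\<^sup>2
      = - (1 / (cosh t * R)) * (sinh t / cosh t + 2 * sinh t * cosh t / (R * R))"
      using R by (simp add: field_simps power2_eq_square)
    finally show ?thesis by (simp only: R(2)[symmetric] R_def[symmetric])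
  qed
  show pos: "0 < arsinh (tanh t)" if "0 < t" for t :: real
    using that by simp
  have sqrt_gt: "cosh t < sqrt (?D t)" if "0 < t" for t :: real
    using that by (intro real_less_rsqrt) simp
  have less: "arsinh (tanh t) < tanh t" if "0 < t" for t :: real
  proof (rule less_if_derivative_less[OF _ has_derivative_arsinh_tanh has_derivative_tanh_cosh _ that])
    show "?h1 x < 1 / (cosh x)\<^sup>2" if "0 < x" for x
      using sqrt_gt[OF that]
      by (intro divide_strict_left_mono)
        (auto simp: power2_eq_square intro!: mult_pos_pos add_pos_nonneg)
  qed simp
  then show "arsinh (tanh t) < sinh t" if "0 < t" for t :: real
    using tanh_less_sinh that by fastforce
  fix t :: real
  assume t: "0 < t"
  define h where "h = arsinh (tanh t)"
  define s where "s = sinh t"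
  define c where "c = cosh t"
  define D where "D = c\<^sup>2 + s\<^sup>2"
  define d where "d = 1 / (c * sqrt D)"
  have c: "c\<^sup>2 = s\<^sup>2 + 1" "c > 0" "s > 0" using t by (simp_all add: c_def s_def cosh_square_eq)
  have D: "D > 0" unfolding D_def using c(2) by (intro add_pos_nonneg) auto
  have d: "d > 0" using c D by (simp add: d_def)
  have h: "0 < h" "h < s / c" using pos less t by (simp_all add: h_def s_def c_def tanh_def)
  have ratio: "1 < sqrt D / c" using sqrt_gt[OF t] c(2) by (simp add: D_def s_def c_def)
  note h(2)
  also have "s / c < s / c * (sqrt D / c)"
    using mult_strict_left_mono[of 1 "sqrt D / c" "s / c"] ratio c by simp
  also have "\<dots> = s * D * d / c"
    using c D by (simp add: d_def field_simps)
  finally have "h < s * D * d / c" .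
  \<comment> \<open>With \<open>d\<close> the derivative of \<open>h\<close>, these are the two linear factors of the quadratic polynomial
    in \<open>h\<close>: the sum of its roots contains \<open>c\<^sup>2 - D\<^sup>2\<close>, which is \<open>- s\<^sup>2 * (D + 2 * c\<^sup>2)\<close>.\<close>
  then have "(h - s * D * d / c) * (h + s * c * d / D) < 0"
    using h c D d by (intro mult_neg_pos add_pos_nonneg) auto
  moreover have "(h - s * D * d / c) * (h + s * c * d / D)
      = h\<^sup>2 + h * (- d * (s / c + 2 * s * c / D)) * s\<^sup>2 - d\<^sup>2 * s\<^sup>2"
  proof -
    have "c / D - D / c = (c\<^sup>2 - D\<^sup>2) / (c * D)"
      using c(2,3) D by (simp add: field_simps power2_eq_square)
    also have "c\<^sup>2 - D\<^sup>2 = - s\<^sup>2 * (D + 2 * c\<^sup>2)"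
      unfolding D_def using c by algebra
    also have "- s\<^sup>2 * (D + 2 * c\<^sup>2) / (c * D) = - s\<^sup>2 * (1 / c + 2 * c / D)"
      using c(2,3) D by (simp add: field_simps power2_eq_square)
    finally have e: "c / D - D / c = - s\<^sup>2 * (1 / c + 2 * c / D)" .
    have "(h - s * D * d / c) * (h + s * c * d / D)
        = h\<^sup>2 + h * s * d * (c / D - D / c) - d\<^sup>2 * s\<^sup>2"
      using c(2,3) D by (simp add: field_simps power2_eq_square)
    also have "\<dots> = h\<^sup>2 + h * (- d * (s / c + 2 * s * c / D)) * s\<^sup>2 - d\<^sup>2 * s\<^sup>2"
      unfolding e by (simp add: algebra_simps)
    finally show ?thesis .
  qed
  ultimately show "(arsinh (tanh t))\<^sup>2
      + arsinh (tanh t) * (- ?h1 t * (sinh t / cosh t + 2 * sinh t * cosh t / ?D t)) * (sinh t)\<^sup>2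
      < (?h1 t)\<^sup>2 * (sinh t)\<^sup>2"
    unfolding h_def s_def c_def D_def d_def by linarith
qed simp_all

section \<open>Monotonicity in the order\<close>

theorem theorem2:
  fixes a b :: real
  assumes "a > 0" and "b > 0" and "a \<noteq> b"
  shows "strict_mono (\<lambda>p. mean_of_order seiffert1 p a b)
    \<and> strict_mono (\<lambda>p. mean_of_order seiffert2 p a b)
    \<and> strict_mono (\<lambda>p. mean_of_order neuman_sandor p a b)
    \<and> strict_mono (\<lambda>p. mean_of_order power_exp_mean p a b)"
  using assms seiffert1_of_order_strict_mono seiffert2_of_order_strict_mono
    neuman_sandor_of_order_strict_mono power_exp_mean_of_order_strict_mono
  by blast

end
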